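(* Let $G^{\varphi}$ be a connected quaternion unit gain graph whose underlying graph $G$ is not a tree. Let $g$ be the girth of $G$ (the length of a shortest cycle) and let $r$ be the rank of the adjacency matrix $A(G^\varphi)$. Then $g \leq r+2$. Moreover, equality $g = r+2$ holds if and only if $g$ is even and one of the following holds: (i) $G^{\varphi}$ is a $g$-cycle (i.e., $G$ is the cycle on $g$ vertices) with gain $(-1)^{g/2}$; (ii) $G$ is a complete bipartite graph with both biparts having at least $2$ vertices, and every $4$-cycle of $G^\varphi$ has gain $1$.
   Context: $\mathbb{H}$ denotes the real quaternions, with conjugation $q\mapsto q^*$ and modulus $|q|=\sqrt{qq^*}$; $U(\mathbb{H})=\{q\in\mathbb{H}:|q|=1\}$. A quaternion unit gain graph $G^\varphi=(G,\varphi)$ consists of a simple graph $G$ with vertex set $\{v_1,\dots,v_n\}$ and a gain function $\varphi$ assigning to each oriented edge $e_{jk}$ (from $v_j$ to $v_k$) a value $\varphi(e_{jk})\in U(\mathbb{H})$ such that $\varphi(e_{jk})=\varphi(e_{kj})^*$. Its adjacency matrix $A(G^\varphi)=(\ell_{jk})$ is the $n\times n$ Hermitian quaternion matrix with $\ell_{jk}=\varphi(e_{jk})$ if $v_j$ is adjacent to $v_k$ and $\ell_{jk}=0$ otherwise. The rank of a quaternion matrix $A\in\mathbb{H}^{m\times n}$ is the minimal $r$ such that $A=BC$ with $B\in\mathbb{H}^{m\times r}$, $C\in\mathbb{H}^{r\times n}$ (equivalently, the maximal number of left linearly independent rows). The gain of a walk $v_0v_1\cdots v_m$ is the product $\varphi(e_{v_0v_1})\varphi(e_{v_1v_2})\cdots\varphi(e_{v_{m-1}v_m})$,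 multiplied in order from left to right. The gain $\varphi(C)$ of a cycle $C$ is the gain of the closed walk around it; it may depend on the starting vertex and direction, but whether $\varphi(C)$ equals a given real number does not, so statements such as "$C$ has gain $1$" or "$C$ has gain $(-1)^{g/2}$" are well defined. *)

theory Defs
  imports
    Complex_Main
    "Jordan_Normal_Form.Matrix"
    "Graph_Theory.Graph_Theory"
begin

section \<open>Quaternions\<close>

text \<open>\<open>Quat a b c d\<close> stands for $a + b i + c j + d k$.\<close>

datatype quat = Quat (qRe: real) (qI: real) (qJ: real) (qK: real)

lemma quat_eq_iff:
  "p = q \<longleftrightarrow> qRe p = qRe q \<and> qI p = qI q \<and> qJ p = qJ q \<and> qK p = qK q"
  by (cases p; cases q) auto

instantiation quat :: ring_1
begin

definition zero_quat :: quat where "0 = Quat 0 0 0 0"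

definition one_quat :: quat where "1 = Quat 1 0 0 0"

definition plus_quat :: "quat \<Rightarrow> quat \<Rightarrow> quat" where
  "p + q = Quat (qRe p + qRe q) (qI p + qI q) (qJ p + qJ q) (qK p + qK q)"

definition minus_quat :: "quat \<Rightarrow> quat \<Rightarrow> quat" where
  "p - q = Quat (qRe p - qRe q) (qI p - qI q) (qJ p - qJ q) (qK p - qK q)"

definition uminus_quat :: "quat \<Rightarrow> quat" where
  "- p = Quat (- qRe p) (- qI p) (- qJ p) (- qK p)"

definition times_quat :: "quat \<Rightarrow> quat \<Rightarrow> quat" where
  "p * q = Quat
     (qRe p * qRe q - qI p * qI q - qJ p * qJ q - qK p * qK q)
     (qRe p * qI q + qI p * qRe q + qJ p * qK q - qK p * qJ q)
     (qRe p * qJ q - qI p * qK q + qJ p * qRe q + qK p * qI q)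
     (qRe p * qK q + qI p * qJ q - qJ p * qI q + qK p * qRe q)"

instance
  by standard
    (simp_all add: quat_eq_iff zero_quat_def one_quat_def plus_quat_def minus_quat_def
      uminus_quat_def times_quat_def algebra_simps)

end

definition qcnj :: "quat \<Rightarrow> quat" where
  "qcnj q = Quat (qRe q) (- qI q) (- qJ q) (- qK q)"

lemma mult_qcnj:
  "q * qcnj q = Quat ((qRe q)\<^sup>2 + (qI q)\<^sup>2 + (qJ q)\<^sup>2 + (qK q)\<^sup>2) 0 0 0"
  by (simp add: quat_eq_iff times_quat_def qcnj_def power2_eq_square)

text \<open>By \<open>mult_qcnj\<close>, \<open>q * qcnj q\<close> is a real quaternion, so taking its real part loses nothing.\<close>

definition qmod :: "quat \<Rightarrow> real" where
  "qmod q = sqrt (qRe (q * qcnj q))"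

definition unit_quats :: "quat set" where
  "unit_quats = {q. qmod q = 1}"

section \<open>Rank of a matrix over a possibly non-commutative ring\<close>

definition factor_rank :: "'a::semiring_0 mat \<Rightarrow> nat" where
  "factor_rank A = (LEAST r. \<exists>B C. B \<in> carrier_mat (dim_row A) r \<and>
     C \<in> carrier_mat r (dim_col A) \<and> A = B * C)"

section \<open>Cycles, girth and trees in simple graphs\<close>

text \<open>
  A simple graph is a \<^locale>\<open>pair_graph\<close>: finite, loop-free, each edge represented by its two
  opposite arcs. Hence \<^const>\<open>pre_digraph.cycle\<close> also admits the closed walks \<open>u v u\<close> of length 2,
  which are not cycles of the simple graph; for the same reason the library's
  \<^const>\<open>Digraph_Component.forest\<close> and \<^const>\<open>Digraph_Component.tree\<close> are not the undirected
  notions. Cycles are given as lists of consecutive arcs.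
\<close>

definition simple_cycle :: "'a pair_pre_digraph \<Rightarrow> ('a \<times> 'a) list \<Rightarrow> bool" where
  "simple_cycle G p \<longleftrightarrow> pre_digraph.cycle (with_proj G) p \<and> 3 \<le> length p"

definition simple_tree :: "'a pair_pre_digraph \<Rightarrow> bool" where
  "simple_tree G \<longleftrightarrow> Digraph_Component.connected (with_proj G) \<and> \<not> (\<exists>p. simple_cycle G p)"

text \<open>Only meaningful for graphs that contain a cycle.\<close>

definition girth :: "'a pair_pre_digraph \<Rightarrow> nat" where
  "girth G = (LEAST l. \<exists>p. simple_cycle G p \<and> length p = l)"

text \<open>\<open>G\<close> consists of exactly the vertices and edges of its cycle \<open>p\<close>.\<close>

definition is_cycle_graph :: "'a pair_pre_digraph \<Rightarrow> ('a \<times> 'a) list \<Rightarrow> bool" where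
  "is_cycle_graph G p \<longleftrightarrow> simple_cycle G p \<and> pverts G = fst ` set p \<and>
     parcs G = set p \<union> (set p)\<inverse>"

section \<open>Quaternion unit gain graphs\<close>

text \<open>The vertices $v_1, \ldots, v_n$ are numbered from \<open>0\<close>, matching matrix indices.\<close>

locale quat_unit_gain_graph = pair_graph G
  for G :: "nat pair_pre_digraph" +
  fixes n :: nat and \<phi> :: "nat \<times> nat \<Rightarrow> quat"
  assumes verts_eq: "pverts G = {0..<n}"
    and gain_unit: "e \<in> parcs G \<Longrightarrow> \<phi> e \<in> unit_quats"
    and gain_cnj: "(j, k) \<in> parcs G \<Longrightarrow> \<phi> (j, k) = qcnj (\<phi> (k, j))"

definition gain_adj_mat :: "nat \<Rightarrow> nat pair_pre_digraph \<Rightarrow> (nat \<times> nat \<Rightarrow> quat) \<Rightarrow> quat mat" where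
  "gain_adj_mat n G \<phi> = mat n n (\<lambda>(j, k). if (j, k) \<in> parcs G then \<phi> (j, k) else 0)"

text \<open>\<^const>\<open>prod_list\<close> multiplies the gains of the successive arcs from left to right.\<close>

definition walk_gain :: "('a \<times> 'a \<Rightarrow> quat) \<Rightarrow> ('a \<times> 'a) list \<Rightarrow> quat" where
  "walk_gain \<phi> p = prod_list (map \<phi> p)"

end

theory Submission
  imports Defs "HOL-Number_Theory.Cong"
begin

text \<open>
  A shortest cycle $v_0 \ldots v_{g-1}$ has no chords, so the rows $v_0, \ldots, v_{g-3}$ and
  columns $v_1, \ldots, v_{g-2}$ form a triangular matrix with nonzero diagonal; hence
  $r \ge g - 2$. If $r = g - 2$, a left combination of rows that vanishes on these columns
  vanishes in every column. Apply this to the rows $v_0, v_2, v_4, \ldots$ with the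
  coefficients $(-1)^i \varphi(v_0 v_1 \cdots v_{2i})$, which cancel in the columns
  $v_1, \ldots, v_{g-2}$: column $v_{g-1}$ shows that $g$ is even and the gain is $(-1)^{g/2}$,
  and the column of an outside neighbour $u$ of $v_0$ shows that $u$ has a second neighbour
  among the even vertices, whence $g = 4$ by minimality of $g$. A triangle-free graph of rank
  $2$ has no induced path on four vertices, so when connected it is complete bipartite.
  Conversely, under (i) the above combination and its shift by one vertex are two relations
  between the rows, and under (ii) every row is a multiple of one of two rows.
\<close>

subsection \<open>Quaternions as a division ring\<close>

instantiation quat :: division_ring
begin

text \<open>The conjugate divided by the squared modulus \<open>N\<close>. At 0 the divisions by 0
  give 0, the value that the class prescribes.\<close>

definition inverse_quat :: "quat \<Rightarrow> quat" where
  "inverse q = (let N = (qRe q)\<^sup>2 + (qI q)\<^sup>2 + (qJ q)\<^sup>2 + (qK q)\<^sup>2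
     in Quat (qRe q / N) (- qI q / N) (- qJ q / N) (- qK q / N))"

definition divide_quat :: "quat \<Rightarrow> quat \<Rightarrow> quat" where
  "p div q = p * inverse (q :: quat)"

instance
proof
  fix q :: quat
  define N where "N = (qRe q)\<^sup>2 + (qI q)\<^sup>2 + (qJ q)\<^sup>2 + (qK q)\<^sup>2"
  assume "q \<noteq> 0"
  then have "N \<noteq> 0"
    unfolding N_def by (auto simp: quat_eq_iff zero_quat_def add_nonneg_eq_0_iff)
  moreover have inv: "inverse q = Quat (qRe q / N) (- qI q / N) (- qJ q / N) (- qK q / N)"
    by (simp add: inverse_quat_def N_def Let_def)
  moreover have "qRe q * qRe q / N + qI q * qI q / N + qJ q * qJ q / N + qK q * qK q / N = N / N"
    unfolding N_def power2_eq_square add_divide_distrib by simp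
  ultimately show "inverse q * q = 1" "q * inverse q = 1"
    by (simp_all add: quat_eq_iff times_quat_def one_quat_def)
qed (simp_all add: divide_quat_def inverse_quat_def zero_quat_def Let_def)

end

lemma unit_quats_mult_qcnj: "q \<in> unit_quats \<Longrightarrow> q * qcnj q = 1"
  by (simp add: unit_quats_def qmod_def mult_qcnj one_quat_def)

lemma unit_quats_nonzero: "q \<in> unit_quats \<Longrightarrow> q \<noteq> 0"
  using unit_quats_mult_qcnj[of q] by auto

subsection \<open>Factor rank over division rings\<close>

text \<open>Gaussian elimination, by induction on the number \<open>r\<close> of coordinates.
  Scalars stay on the left throughout, since multiplication need not commute.\<close>

lemma left_linear_dependence:
  fixes b :: "'i \<Rightarrow> nat \<Rightarrow> 'a::division_ring"
  assumes "finite I" and "r < card I"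
  shows "\<exists>x. (\<exists>i\<in>I. x i \<noteq> 0) \<and> (\<forall>k<r. (\<Sum>i\<in>I. x i * b i k) = 0)"
  using assms
proof (induction r arbitrary: I b)
  case 0
  then have "I \<noteq> {}" by auto
  then show ?case by (intro exI[of _ "\<lambda>_. 1"]) auto
next
  case (Suc r)
  show ?case
  proof (cases "\<forall>i\<in>I. b i r = 0")
    case True
    from Suc.IH[of I b] Suc.prems obtain x
      where "\<exists>i\<in>I. x i \<noteq> 0" "\<forall>k<r. (\<Sum>i\<in>I. x i * b i k) = 0"
      by auto
    with True show ?thesis
      by (intro exI[of _ x]) (auto simp: less_Suc_eq)
  next
    case False
    then obtain p where p: "p \<in> I" "b p r \<noteq> 0" by auto
    define J where "J = I - {p}"
    define u where "u i = b i r * inverse (b p r)" for i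
    define b' where "b' i k = b i k - u i * b p k" for i k
    have J: "finite J" "I = insert p J" "p \<notin> J" "r < card J"
      using p Suc.prems unfolding J_def by auto
    from Suc.IH[OF J(1,4), of b'] obtain x
      where x: "\<exists>i\<in>J. x i \<noteq> 0" "\<And>k. k < r \<Longrightarrow> (\<Sum>i\<in>J. x i * b' i k) = 0"
      by auto
    \<comment> \<open>The coefficient of the pivot \<open>p\<close> is chosen so that
      \<open>y\<close> combines the \<open>b i\<close> to the same vector as \<open>x\<close>
      combines the reduced \<open>b' i\<close>.\<close>
    define y where "y = x(p := - (\<Sum>i\<in>J. x i * u i))"
    have y: "y i = x i" if "i \<in> J" for i
      using that J(3) by (auto simp: y_def)
    have "(\<Sum>i\<in>I. y i * b i k) = (\<Sum>i\<in>J. x i * b' i k)" for k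
    proof -
      have "(\<Sum>i\<in>I. y i * b i k) = y p * b p k + (\<Sum>i\<in>J. x i * b i k)"
        using J y by (simp cong: sum.cong)
      also have "\<dots> = (\<Sum>i\<in>J. x i * b' i k)"
        by (simp add: y_def b'_def sum_distrib_right right_diff_distrib sum_subtractf mult.assoc)
      finally show ?thesis .
    qed
    moreover have "b' i r = 0" for i
      using p by (simp add: b'_def u_def mult.assoc)
    ultimately have "(\<Sum>i\<in>I. y i * b i k) = 0" if "k < Suc r" for k
      using that x(2) by (auto simp: less_Suc_eq)
    moreover have "\<exists>i\<in>I. y i \<noteq> 0"
      using x(1) y J by auto
    ultimately show ?thesis by blast
  qed
qed

text \<open>The minimum that defines \<open>factor_rank\<close> is attained, because multiplying
  \<open>A\<close> by the identity shows that some factorization exists.\<close>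

lemma factor_rank_factorization:
  fixes A :: "'a::semiring_1 mat"
  assumes "A \<in> carrier_mat m n"
  obtains B C where
    "\<And>i j. i < m \<Longrightarrow> j < n \<Longrightarrow> A $$ (i, j) = (\<Sum>k<factor_rank A. B i k * C k j)"
proof -
  have "\<exists>r B C. B \<in> carrier_mat (dim_row A) r \<and> C \<in> carrier_mat r (dim_col A) \<and> A = B * C"
    by (intro exI[of _ "dim_col A"] exI[of _ A] exI[of _ "1\<^sub>m (dim_col A)"]) auto
  from LeastI_ex[OF this] obtain B C
    where BC: "B \<in> carrier_mat (dim_row A) (factor_rank A)"
      "C \<in> carrier_mat (factor_rank A) (dim_col A)" "A = B * C"
    unfolding factor_rank_def by blast
  have "A $$ (i, j) = (\<Sum>k<factor_rank A. B $$ (i, k) * C $$ (k, j))" if "i < m" "j < n" for i j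
  proof -
    have "A $$ (i, j) = (B * C) $$ (i, j)" using BC(3) by simp
    also have "\<dots> = (\<Sum>k<factor_rank A. B $$ (i, k) * C $$ (k, j))"
      using BC(1,2) assms that
      by (auto simp: scalar_prod_def atLeast0LessThan intro!: sum.cong)
    finally show ?thesis .
  qed
  then show thesis using that[of "\<lambda>i k. B $$ (i, k)" "\<lambda>k j. C $$ (k, j)"] by blast
qed

lemma factor_rank_le:
  fixes A :: "'a::semiring_0 mat"
  assumes A: "A \<in> carrier_mat m n"
    and \<rho>: "\<And>t. t < k \<Longrightarrow> \<rho> t < m"
    and span: "\<And>i. i < m \<Longrightarrow> \<exists>f. \<forall>j<n. A $$ (i, j) = (\<Sum>t<k. f t * A $$ (\<rho> t, j))"
  shows "factor_rank A \<le> k"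
proof -
  from span obtain f
    where f: "\<And>i j. i < m \<Longrightarrow> j < n \<Longrightarrow> A $$ (i, j) = (\<Sum>t<k. f i t * A $$ (\<rho> t, j))"
    by metis
  define B where "B = mat m k (\<lambda>(i, t). f i t)"
  define C where "C = mat k n (\<lambda>(t, j). A $$ (\<rho> t, j))"
  have "A = B * C"
    using A by (intro eq_matI) (auto simp: B_def C_def f scalar_prod_def atLeast0LessThan)
  moreover have "B \<in> carrier_mat (dim_row A) k" "C \<in> carrier_mat k (dim_col A)"
    using A by (auto simp: B_def C_def)
  ultimately show ?thesis
    unfolding factor_rank_def by (intro Least_le) blast
qed

section \<open>Triangular submatrices and the rank\<close>

lemma triangular_left_injective:
  fixes z :: "nat \<Rightarrow> 'a::division_ring"
  assumes diag: "\<And>i. i < m \<Longrightarrow> M i i \<noteq> 0"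
    and upper: "\<And>i j. i < j \<Longrightarrow> j < m \<Longrightarrow> M i j = 0"
    and kernel: "\<And>j. j < m \<Longrightarrow> (\<Sum>i<m. z i * M i j) = 0"
    and "i < m"
  shows "z i = 0"
proof (rule ccontr)
  assume "z i \<noteq> 0"
  \<comment> \<open>In column \<open>l\<close>, for the largest \<open>l\<close> with a nonzero
    coefficient, only the diagonal term survives: earlier rows vanish there by \<open>upper\<close>,
    later rows have coefficient 0.\<close>
  define l where "l = Max {i. i < m \<and> z i \<noteq> 0}"
  have "l \<in> {i. i < m \<and> z i \<noteq> 0}"
    unfolding l_def using \<open>i < m\<close> \<open>z i \<noteq> 0\<close> by (intro Max_in) auto
  then have l: "l < m" "z l \<noteq> 0" by auto
  have above: "z i = 0" if "l < i" "i < m" for i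
    using Max_ge[of "{i. i < m \<and> z i \<noteq> 0}" i] that unfolding l_def by fastforce
  have "z i * M i l = 0" if "i < m" "i \<noteq> l" for i
    using that l above[of i] upper[of i l] by (cases "i < l") auto
  then have "(\<Sum>i\<in>{..<m} - {l}. z i * M i l) = 0"
    by (intro sum.neutral) blast
  then have "(\<Sum>i<m. z i * M i l) = z l * M l l"
    using l by (subst sum.remove[of _ l]) simp_all
  then show False using kernel[OF l(1)] l diag by simp
qed

text \<open>If the inner dimension of a factorization were below \<open>m\<close>, the
  \<open>m\<close> chosen rows of the left factor would be dependent. The triangular submatrix would
  inherit that relation, which its injectivity excludes.\<close>

lemma triangular_factor_rank:
  fixes A :: "'a::division_ring mat"
  assumes A: "A \<in> carrier_mat p q"
    and idx: "\<And>i. i < m \<Longrightarrow> \<rho> i < p" "\<And>i. i < m \<Longrightarrow> \<sigma> i < q"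
    and diag: "\<And>i. i < m \<Longrightarrow> A $$ (\<rho> i, \<sigma> i) \<noteq> 0"
    and upper: "\<And>i j. i < j \<Longrightarrow> j < m \<Longrightarrow> A $$ (\<rho> i, \<sigma> j) = 0"
  shows "m \<le> factor_rank A"
proof (rule ccontr)
  assume "\<not> m \<le> factor_rank A"
  obtain B C where
    BC: "\<And>i j. i < p \<Longrightarrow> j < q \<Longrightarrow> A $$ (i, j) = (\<Sum>k<factor_rank A. B i k * C k j)"
    using factor_rank_factorization[OF A] by blast
  from left_linear_dependence[of "{..<m}" "factor_rank A" "\<lambda>i. B (\<rho> i)"]
    \<open>\<not> m \<le> factor_rank A\<close> obtain x
    where x: "\<exists>i<m. x i \<noteq> 0" "\<And>k. k < factor_rank A \<Longrightarrow> (\<Sum>i<m. x i * B (\<rho> i) k) = 0"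
    by auto
  have "(\<Sum>i<m. x i * A $$ (\<rho> i, \<sigma> j)) = 0" if "j < m" for j
  proof -
    have "(\<Sum>i<m. x i * A $$ (\<rho> i, \<sigma> j))
        = (\<Sum>i<m. \<Sum>k<factor_rank A. x i * B (\<rho> i) k * C k (\<sigma> j))"
      using that idx by (auto simp: BC sum_distrib_left mult.assoc intro!: sum.cong)
    also have "\<dots> = (\<Sum>k<factor_rank A. (\<Sum>i<m. x i * B (\<rho> i) k) * C k (\<sigma> j))"
      by (subst sum.swap) (simp add: sum_distrib_right)
    finally show ?thesis using x(2) by simp
  qed
  with triangular_left_injective[of m "\<lambda>i j. A $$ (\<rho> i, \<sigma> j)" x] diag upper x(1)
  show False by blast
qed

text \<open>If a triangular submatrix already has the full rank, the row space of \<open>A\<close> projects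
  injectively onto its columns.\<close>

lemma row_combination_vanishes:
  fixes A :: "'a::division_ring mat"
  assumes A: "A \<in> carrier_mat p q"
    and idx: "\<And>i. i < m \<Longrightarrow> \<rho> i < p" "\<And>i. i < m \<Longrightarrow> \<sigma> i < q"
    and diag: "\<And>i. i < m \<Longrightarrow> A $$ (\<rho> i, \<sigma> i) \<noteq> 0"
    and upper: "\<And>i j. i < j \<Longrightarrow> j < m \<Longrightarrow> A $$ (\<rho> i, \<sigma> j) = 0"
    and rank: "factor_rank A = m"
    and \<tau>: "\<And>t. t \<in> T \<Longrightarrow> \<tau> t < p"
    and zero: "\<And>j. j < m \<Longrightarrow> (\<Sum>t\<in>T. x t * A $$ (\<tau> t, \<sigma> j)) = 0"
    and "j < q"
  shows "(\<Sum>t\<in>T. x t * A $$ (\<tau> t, j)) = 0"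
proof -
  obtain B C where
    BC: "\<And>i j. i < p \<Longrightarrow> j < q \<Longrightarrow> A $$ (i, j) = (\<Sum>k<m. B i k * C k j)"
    using factor_rank_factorization[OF A] rank by metis
  \<comment> \<open>The row combination in question is \<open>y\<close> times the right factor
    \<open>C\<close>, so it suffices to show that \<open>y\<close> is 0.\<close>
  define y where "y k = (\<Sum>t\<in>T. x t * B (\<tau> t) k)" for k
  have comb: "(\<Sum>t\<in>T. x t * A $$ (\<tau> t, j)) = (\<Sum>k<m. y k * C k j)" if "j < q" for j
  proof -
    have "(\<Sum>t\<in>T. x t * A $$ (\<tau> t, j)) = (\<Sum>t\<in>T. \<Sum>k<m. x t * B (\<tau> t) k * C k j)"
      using that \<tau> by (auto simp: BC sum_distrib_left mult.assoc intro!: sum.cong)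
    also have "\<dots> = (\<Sum>k<m. y k * C k j)"
      by (subst sum.swap) (simp add: sum_distrib_right y_def)
    finally show ?thesis .
  qed
  \<comment> \<open>The \<open>m\<close> triangular rows of the left factor together with
    \<open>y\<close> are \<open>m + 1\<close> vectors with \<open>m\<close> coordinates, hence
    dependent.\<close>
  define b where "b i = (if i < m then B (\<rho> i) else y)" for i
  from left_linear_dependence[of "{..<Suc m}" m b] obtain z
    where z: "\<exists>i<Suc m. z i \<noteq> 0" "\<And>k. k < m \<Longrightarrow> (\<Sum>i<Suc m. z i * b i k) = 0"
    by auto
  have dep: "(\<Sum>i<m. z i * B (\<rho> i) k) = - (z m * y k)" if "k < m" for k
    using z(2)[OF that] by (simp add: b_def eq_neg_iff_add_eq_0)
  have "(\<Sum>i<m. z i * A $$ (\<rho> i, \<sigma> j)) = 0" if "j < m" for j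
  proof -
    have "(\<Sum>i<m. z i * A $$ (\<rho> i, \<sigma> j)) = (\<Sum>i<m. \<Sum>k<m. z i * B (\<rho> i) k * C k (\<sigma> j))"
      using that idx by (auto simp: BC sum_distrib_left mult.assoc intro!: sum.cong)
    also have "\<dots> = (\<Sum>k<m. (\<Sum>i<m. z i * B (\<rho> i) k) * C k (\<sigma> j))"
      by (subst sum.swap) (simp add: sum_distrib_right)
    also have "\<dots> = - (z m * (\<Sum>k<m. y k * C k (\<sigma> j)))"
      by (simp add: dep sum_distrib_left sum_negf mult.assoc)
    also have "\<dots> = 0"
      using comb[of "\<sigma> j"] zero[OF that] idx that by simp
    finally show ?thesis .
  qed
  \<comment> \<open>In the columns \<open>\<sigma> j\<close> the contribution of \<open>y\<close>
    vanishes by \<open>zero\<close>, so the triangular rows satisfy a relation by themselves and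
    their coefficients are 0. Only the coefficient of \<open>y\<close> can then be nonzero.\<close>
  then have z0: "z i = 0" if "i < m" for i
    using triangular_left_injective[of m "\<lambda>i j. A $$ (\<rho> i, \<sigma> j)" z i] diag upper that by blast
  with z(1) have "z m \<noteq> 0" by (auto simp: less_Suc_eq)
  then have "y k = 0" if "k < m" for k
    using dep[OF that] z0 by simp
  then show ?thesis using comb[OF \<open>j < q\<close>] by simp
qed

subsection \<open>Cycles as periodic vertex sequences\<close>

text \<open>Indexing the vertices by all naturals with period \<open>k\<close> avoids wrap-around
  when the start vertex moves. The last condition expresses periodicity and distinctness within one
  round at once.\<close>

definition periodic_cycle :: "('a \<times> 'a) set \<Rightarrow> nat \<Rightarrow> (nat \<Rightarrow> 'a) \<Rightarrow> bool" where
  "periodic_cycle E k v \<longleftrightarrow>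
     3 \<le> k \<and> (\<forall>i. (v i, v (Suc i)) \<in> E) \<and> (\<forall>i j. v i = v j \<longleftrightarrow> i mod k = j mod k)"

definition walk_arcs :: "(nat \<Rightarrow> 'a) \<Rightarrow> nat \<Rightarrow> ('a \<times> 'a) list" where
  "walk_arcs v k = map (\<lambda>i. (v i, v (Suc i))) [0..<k]"

lemma length_walk_arcs [simp]: "length (walk_arcs v k) = k"
  by (simp add: walk_arcs_def)

lemma walk_arcs_0 [simp]: "walk_arcs v 0 = []"
  by (simp add: walk_arcs_def)

lemma walk_arcs_Suc: "walk_arcs v (Suc k) = walk_arcs v k @ [(v k, v (Suc k))]"
  by (simp add: walk_arcs_def)

lemma walk_arcs_Suc_shift:
  "walk_arcs v (Suc k) = (v 0, v 1) # walk_arcs (\<lambda>i. v (Suc i)) k"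
  unfolding walk_arcs_def by (subst upt_conv_Cons) (auto simp: map_Suc_upt[symmetric] simp del: upt_Suc)

lemma periodic_cycleI:
  assumes "3 \<le> k" and "inj_on w {..<k}"
    and "\<And>i. Suc i < k \<Longrightarrow> (w i, w (Suc i)) \<in> E" and "(w (k - 1), w 0) \<in> E"
  shows "periodic_cycle E k (\<lambda>i. w (i mod k))"
  unfolding periodic_cycle_def
proof (intro conjI allI)
  show "3 \<le> k" by fact
next
  fix i
  have "i mod k < k" "Suc (i mod k) = k \<Longrightarrow> i mod k = k - 1" using assms(1) by simp_all
  then show "(w (i mod k), w (Suc i mod k)) \<in> E"
    using assms(3)[of "i mod k"] assms(4) by (cases "Suc (i mod k) = k") (auto simp: mod_Suc)
next
  fix i j
  show "w (i mod k) = w (j mod k) \<longleftrightarrow> i mod k = j mod k"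
    using assms(1,2) by (auto simp: inj_on_eq_iff)
qed

context
  fixes E :: "('a \<times> 'a) set" and k :: nat and v :: "nat \<Rightarrow> 'a"
  assumes cyc: "periodic_cycle E k v"
begin

lemma periodic_cycle_length: "3 \<le> k"
  using cyc by (simp add: periodic_cycle_def)

lemma periodic_cycle_arc: "(v i, v (Suc i)) \<in> E"
  using cyc by (simp add: periodic_cycle_def)

lemma periodic_cycle_eq_iff: "v i = v j \<longleftrightarrow> i mod k = j mod k"
  using cyc by (simp add: periodic_cycle_def)

lemma periodic_cycle_mod: "v (i mod k) = v i"
  by (simp add: periodic_cycle_eq_iff)

lemma periodic_cycle_inj_on: "inj_on v {..<k}"
  by (auto simp: inj_on_def periodic_cycle_eq_iff)

lemma periodic_cycle_range: "range v = v ` {..<k}"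
proof -
  have "v i \<in> v ` {..<k}" for i
    using periodic_cycle_mod[of i] periodic_cycle_length
    by (metis imageI lessThan_iff mod_less_divisor not_numeral_le_zero not_gr_zero)
  then show ?thesis by auto
qed

text \<open>Lets facts about the start vertex \<open>v 0\<close> be used at any vertex of the
  cycle.\<close>

lemma periodic_cycle_shift: "periodic_cycle E k (\<lambda>i. v (i + m))"
proof -
  have "(i + m) mod k = (j + m) mod k \<longleftrightarrow> i mod k = j mod k" for i j
    using cong_add_rcancel_nat[of i m j k] by (simp add: cong_def)
  then show ?thesis
    using periodic_cycle_length periodic_cycle_arc[of "_ + m"]
    by (auto simp: periodic_cycle_def periodic_cycle_eq_iff)
qed

text \<open>The path \<open>v 0, ..., v m\<close> returns to \<open>v 0\<close> through the outside
  vertex \<open>u\<close>, which gives \<open>m + 2\<close> distinct vertices.\<close>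

lemma periodic_cycle_detour:
  assumes "1 \<le> m" "m < k" "u \<notin> range v" "(v m, u) \<in> E" "(u, v 0) \<in> E"
  shows "\<exists>w. periodic_cycle E (m + 2) w"
proof -
  define w where "w i = (if i \<le> m then v i else u)" for i
  have "inj_on w {..<m + 2}"
  proof (rule inj_onI)
    fix i j assume "i \<in> {..<m + 2}" "j \<in> {..<m + 2}" "w i = w j"
    then show "i = j"
      using assms(2,3) by (auto simp: w_def periodic_cycle_eq_iff split: if_splits)
  qed
  moreover have "(w i, w (Suc i)) \<in> E" if "Suc i < m + 2" for i
    using that assms(4) periodic_cycle_arc[of i] by (auto simp: w_def le_less_Suc_eq not_le)
  ultimately show ?thesis
    using assms(1,5) periodic_cycleI[of "m + 2" w E] by (auto simp: w_def)
qed

lemma periodic_cycle_chord: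
  assumes "2 \<le> m" "m < k" "(v m, v 0) \<in> E"
  shows "\<exists>w. periodic_cycle E (Suc m) w"
proof -
  have "inj_on v {..<Suc m}"
    using periodic_cycle_inj_on assms(2) by (auto intro: inj_on_subset)
  then show ?thesis
    using assms periodic_cycle_arc periodic_cycleI[of "Suc m" v E] by auto
qed

end

text \<open>Translates between arc lists and periodic vertex sequences, so that the rest can work
  with indices.\<close>

lemma (in pair_wf_digraph) simple_cycle_iff:
  "simple_cycle G p \<longleftrightarrow>
     (\<exists>v. periodic_cycle (parcs G) (length p) v \<and> p = walk_arcs v (length p))"
proof
  \<comment> \<open>Along a walk each head is the next tail. For a closed walk, heads and tails
    therefore form the same multiset, which carries distinctness from the heads, as
    \<open>cycle\<close> states it, to the tails \<open>w i\<close>.\<close>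
  have fst_snd: "map fst p @ [w] = u # map snd p" if "cas u p w" for u p w
    using that by (induction p arbitrary: u) auto
  assume "simple_cycle G p"
  then obtain u where p: "3 \<le> length p" "set p \<subseteq> parcs G" "cas u p u"
      "distinct (tl (awalk_verts u p))"
    by (auto simp: simple_cycle_def cycle_def awalk_def)
  let ?k = "length p"
  have nonempty: "p \<noteq> []" using p(1) by auto
  have eq: "map fst p @ [u] = u # map snd p" using fst_snd p(3) by blast
  have "tl (awalk_verts u p) = map snd p"
    using p(3) nonempty by (subst awalk_verts_conv'[OF p(3)]) simp
  moreover have "mset (map fst p) = mset (map snd p)"
    using arg_cong[OF eq, of mset] by simp
  ultimately have dist: "distinct (map fst p)"
    using p(4) mset_eq_imp_distinct_iff by metis
  define w where "w i = fst (p ! i)" for i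
  have inj: "inj_on w {..<?k}"
    using dist by (auto simp: inj_on_def w_def distinct_conv_nth)
  have suc: "snd (p ! i) = w (Suc i)" if "Suc i < ?k" for i
    using arg_cong[OF eq, of "\<lambda>l. l ! Suc i"] that by (simp add: w_def nth_append)
  have lst: "snd (p ! (?k - 1)) = w 0"
    using arg_cong[OF eq, of "\<lambda>l. l ! ?k"] arg_cong[OF eq, of "\<lambda>l. l ! 0"] nonempty
    by (simp add: w_def nth_append nth_Cons')
  have nth: "p ! i = (w i, w (Suc i mod ?k))" if "i < ?k" for i
  proof (cases "Suc i = ?k")
    case True
    then have "i = ?k - 1" by simp
    then show ?thesis using lst True by (simp add: prod_eq_iff w_def)
  next
    case False
    then show ?thesis using suc[of i] that by (simp add: prod_eq_iff w_def)
  qed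
  have arc: "p ! i \<in> parcs G" if "i < ?k" for i
    using p(2) that by auto
  have "periodic_cycle (parcs G) ?k (\<lambda>i. w (i mod ?k))"
  proof (rule periodic_cycleI[OF p(1) inj])
    show "(w i, w (Suc i)) \<in> parcs G" if "Suc i < ?k" for i
      using arc[of i] nth[of i] that by simp
    show "(w (?k - 1), w 0) \<in> parcs G"
      using arc[of "?k - 1"] nth[of "?k - 1"] nonempty by simp
  qed
  moreover have "p = walk_arcs (\<lambda>i. w (i mod ?k)) ?k"
    by (rule nth_equalityI) (simp_all add: nth walk_arcs_def)
  ultimately show "\<exists>v. periodic_cycle (parcs G) ?k v \<and> p = walk_arcs v ?k"
    by blast
next
  assume "\<exists>v. periodic_cycle (parcs G) (length p) v \<and> p = walk_arcs v (length p)"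
  then obtain v k where v: "periodic_cycle (parcs G) k v" "p = walk_arcs v k" "k = length p"
    by blast
  note len = periodic_cycle_length[OF v(1)] and arc = periodic_cycle_arc[OF v(1)]
    and eq_iff = periodic_cycle_eq_iff[OF v(1)]
  have "cas (v 0) (walk_arcs v m) (v m)" for v m
    by (induction m arbitrary: v) (auto simp: walk_arcs_Suc_shift)
  moreover have "v k = v 0" by (simp add: eq_iff)
  ultimately have cas: "cas (v 0) p (v 0)" using v(2) by metis
  have nonempty: "p \<noteq> []" using v(3) len by auto
  have "tl (awalk_verts (v 0) p) = map snd p"
    using nonempty by (subst awalk_verts_conv'[OF cas]) simp
  also have "\<dots> = map (\<lambda>i. v (Suc i)) [0..<k]"
    by (simp add: v(2) walk_arcs_def)
  also have "distinct \<dots>"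
    using periodic_cycle_inj_on[OF periodic_cycle_shift[OF v(1), of 1]]
    by (simp add: distinct_map atLeast0LessThan)
  finally have "distinct (tl (awalk_verts (v 0) p))" .
  moreover have "set p \<subseteq> parcs G" using arc by (auto simp: v(2) walk_arcs_def)
  moreover have "v 0 \<in> pverts G" using arc[of 0] in_arcsD1 by auto
  ultimately show "simple_cycle G p"
    using cas nonempty len v(3) unfolding simple_cycle_def cycle_def awalk_def by auto
qed

section \<open>Shortest cycles and connectedness\<close>

context pair_wf_digraph
begin

lemma girth_le: "periodic_cycle (parcs G) k v \<Longrightarrow> girth G \<le> k"
  unfolding girth_def by (rule Least_le) (metis length_walk_arcs simple_cycle_iff)

lemma girth_attained:
  assumes "simple_cycle G p"
  obtains v where "periodic_cycle (parcs G) (girth G) v"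
proof -
  have "\<exists>l p. simple_cycle G p \<and> length p = l" using assms by blast
  from LeastI_ex[OF this] show thesis
    using that simple_cycle_iff unfolding girth_def by metis
qed

end

text \<open>A chord would cut off a shorter cycle. The arcs between the indices 0 and
  \<open>girth G - 1\<close> close the cycle and are not chords.\<close>

lemma (in pair_graph) girth_cycle_chordless:
  assumes cyc: "periodic_cycle (parcs G) (girth G) v"
    and "i < girth G" "j < girth G"
  shows "(v i, v j) \<in> parcs G \<longleftrightarrow>
    j = Suc i \<or> i = Suc j \<or> i = 0 \<and> j = girth G - 1 \<or> j = 0 \<and> i = girth G - 1"
proof -
  let ?g = "girth G"
  note len = periodic_cycle_length[OF cyc]
  have sym: "(x, y) \<in> parcs G \<longleftrightarrow> (y, x) \<in> parcs G" for x y
    using arcs_symmetric by blast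
  have upper: "(v i, v j) \<in> parcs G \<longleftrightarrow> j = Suc i \<or> i = 0 \<and> j = ?g - 1"
    if "i < j" "j < ?g" for i j
  proof
    assume arc: "(v i, v j) \<in> parcs G"
    have "?g \<le> Suc (j - i)" if "2 \<le> j - i"
    proof -
      \<comment> \<open>After a shift by \<open>i\<close> the chord joins the start vertex to the
        one with index \<open>j - i\<close>.\<close>
      have "(v (j - i + i), v (0 + i)) \<in> parcs G" "j - i < ?g"
        using \<open>i < j\<close> \<open>j < ?g\<close> arc sym by simp_all
      then show ?thesis
        using periodic_cycle_chord[OF periodic_cycle_shift[OF cyc, of i] that] girth_le by blast
    qed
    then show "j = Suc i \<or> i = 0 \<and> j = ?g - 1"
      using that by linarith
  next
    have "v (Suc (?g - 1)) = v 0"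
      using len by (simp add: periodic_cycle_eq_iff[OF cyc])
    then have "(v (?g - 1), v 0) \<in> parcs G"
      using periodic_cycle_arc[OF cyc, of "?g - 1"] by simp
    moreover assume "j = Suc i \<or> i = 0 \<and> j = ?g - 1"
    ultimately show "(v i, v j) \<in> parcs G"
      using periodic_cycle_arc[OF cyc] sym by auto
  qed
  consider "i < j" | "j < i" | "i = j" by linarith
  then show ?thesis
  proof cases
    case 1
    then show ?thesis using upper[of i j] assms len by auto
  next
    case 2
    then show ?thesis using upper[of j i] sym[of "v i" "v j"] assms len by auto
  next
    case 3
    then show ?thesis using len no_loops[of "(v i, v i)"] by auto
  qed
qed

lemma (in pair_graph) connected_closed_set:
  assumes "Digraph_Component.connected (with_proj G)"
    and "U \<subseteq> pverts G" "x \<in> U"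
    and closed: "\<And>x y. x \<in> U \<Longrightarrow> (x, y) \<in> parcs G \<Longrightarrow> y \<in> U"
  shows "U = pverts G"
proof -
  have "y \<in> U" if "y \<in> pverts G" for y
  proof -
    have "x \<rightarrow>\<^sup>*\<^bsub>with_proj (mk_symmetric (with_proj G))\<^esub> y"
      using assms(1-3) that
      by (auto simp: connected_def strongly_connected_def)
    \<comment> \<open>Connectedness is defined through the symmetric closure, but the arcs of
      \<open>G\<close> are symmetric already.\<close>
    then have "x \<rightarrow>\<^sup>*\<^bsub>with_proj G\<^esub> y"
      using reachable_mk_symmetric_eq[OF sym_arcs] by simp
    then show ?thesis
      using assms(3) closed by (induction rule: reachable_induct) auto
  qed
  then show ?thesis using assms(2) by auto
qed

subsection \<open>Gains and the adjacency matrix\<close>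

lemma walk_gain_Nil [simp]: "walk_gain \<phi> [] = 1"
  by (simp add: walk_gain_def)

lemma walk_gain_Suc:
  "walk_gain \<phi> (walk_arcs v (Suc k)) = walk_gain \<phi> (walk_arcs v k) * \<phi> (v k, v (Suc k))"
  by (simp add: walk_gain_def walk_arcs_Suc)

lemma walk_gain_Suc_shift:
  "walk_gain \<phi> (walk_arcs v (Suc k)) = \<phi> (v 0, v 1) * walk_gain \<phi> (walk_arcs (\<lambda>i. v (Suc i)) k)"
  by (simp add: walk_gain_def walk_arcs_Suc_shift)

text \<open>With these coefficients on the rows of the even vertices \<open>v (2 * i)\<close> the entries in
  the column of an odd vertex cancel between its two neighbours.\<close>

definition even_coeff :: "('a \<times> 'a \<Rightarrow> quat) \<Rightarrow> (nat \<Rightarrow> 'a) \<Rightarrow> nat \<Rightarrow> quat" where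
  "even_coeff \<phi> v i = (-1) ^ i * walk_gain \<phi> (walk_arcs v (2 * i))"

context quat_unit_gain_graph
begin

abbreviation adj_mat :: "quat mat" where
  "adj_mat \<equiv> gain_adj_mat n G \<phi>"

lemma adj_mat_carrier: "adj_mat \<in> carrier_mat n n"
  by (simp add: gain_adj_mat_def)

lemma arc_verts: "(x, y) \<in> parcs G \<Longrightarrow> x < n \<and> y < n"
  using in_arcsD1[of x y] in_arcsD2[of x y] verts_eq by auto

lemma arc_sym: "(x, y) \<in> parcs G \<longleftrightarrow> (y, x) \<in> parcs G"
  using arcs_symmetric by blast

lemma arc_irrefl: "(x, x) \<notin> parcs G"
  using no_loops[of "(x, x)"] by auto

lemma adj_mat_arc: "(x, y) \<in> parcs G \<Longrightarrow> adj_mat $$ (x, y) = \<phi> (x, y)"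
  using arc_verts[of x y] by (simp add: gain_adj_mat_def)

lemma adj_mat_no_arc:
  "x < n \<Longrightarrow> y < n \<Longrightarrow> (x, y) \<notin> parcs G \<Longrightarrow> adj_mat $$ (x, y) = 0"
  by (simp add: gain_adj_mat_def)

lemma gain_nonzero: "e \<in> parcs G \<Longrightarrow> \<phi> e \<noteq> 0"
  by (rule unit_quats_nonzero) (rule gain_unit)

lemma gain_mult_rev:
  assumes "(x, y) \<in> parcs G"
  shows "\<phi> (x, y) * \<phi> (y, x) = 1"
proof -
  have "\<phi> (y, x) = qcnj (\<phi> (x, y))"
    using gain_cnj[of y x] assms arc_sym by blast
  then show ?thesis using unit_quats_mult_qcnj gain_unit[OF assms] by simp
qed

lemma walk_gain_nonzero:
  assumes "\<And>i. (v i, v (Suc i)) \<in> parcs G"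
  shows "walk_gain \<phi> (walk_arcs v k) \<noteq> 0"
  by (induction k) (simp_all add: walk_gain_Suc gain_nonzero assms)

lemma even_coeff_nonzero:
  assumes "\<And>i. (v i, v (Suc i)) \<in> parcs G"
  shows "even_coeff \<phi> v k \<noteq> 0"
  using walk_gain_nonzero[of v] assms by (simp add: even_coeff_def)

text \<open>From one coefficient to the next the sign flips and the walk grows by two arcs. The
  second of them is undone by the reverse arc in the matrix entry.\<close>

lemma even_coeff_cancel:
  assumes "\<And>i. (v i, v (Suc i)) \<in> parcs G"
  shows "even_coeff \<phi> v i * \<phi> (v (2 * i), v (Suc (2 * i)))
    + even_coeff \<phi> v (Suc i) * \<phi> (v (Suc (Suc (2 * i))), v (Suc (2 * i))) = 0"
proof -
  let ?w = "walk_gain \<phi> (walk_arcs v (2 * i)) * \<phi> (v (2 * i), v (Suc (2 * i)))"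
  have "even_coeff \<phi> v (Suc i) * \<phi> (v (Suc (Suc (2 * i))), v (Suc (2 * i)))
    = (-1) ^ Suc i * (?w * (\<phi> (v (Suc (2 * i)), v (Suc (Suc (2 * i))))
        * \<phi> (v (Suc (Suc (2 * i))), v (Suc (2 * i)))))"
    by (simp add: even_coeff_def walk_gain_Suc mult.assoc)
  also have "\<dots> = (-1) ^ Suc i * ?w"
    using gain_mult_rev[OF assms[of "Suc (2 * i)"]] by simp
  finally show ?thesis by (simp add: even_coeff_def mult.assoc)
qed

lemma walk_gain_Suc_eq_iff:
  assumes "\<And>i. (v i, v (Suc i)) \<in> parcs G"
  shows "walk_gain \<phi> (walk_arcs v (Suc k)) = c \<longleftrightarrow>
    walk_gain \<phi> (walk_arcs v k) = c * \<phi> (v (Suc k), v k)"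
proof -
  let ?p = "\<phi> (v k, v (Suc k))" and ?q = "\<phi> (v (Suc k), v k)"
  have "?p * ?q = 1" "?q * ?p = 1"
    using gain_mult_rev assms arc_sym by blast+
  then show ?thesis
    by (metis walk_gain_Suc mult.assoc mult.right_neutral)
qed

text \<open>Moving the start along one arc conjugates the gain of the closed walk by the gain of
  that arc, and \<open>(-1) ^ h\<close> is central.\<close>

lemma walk_gain_shift:
  assumes arc: "\<And>i. (v i, v (Suc i)) \<in> parcs G" and "v k = v 0" "v (Suc k) = v 1"
    and gain: "walk_gain \<phi> (walk_arcs v k) = (-1) ^ h"
  shows "walk_gain \<phi> (walk_arcs (\<lambda>i. v (Suc i)) k) = (-1) ^ h"
proof -
  let ?p = "\<phi> (v 0, v 1)"
  have "?p * walk_gain \<phi> (walk_arcs (\<lambda>i. v (Suc i)) k) = (-1) ^ h * ?p"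
    using walk_gain_Suc_shift[of \<phi> v k] walk_gain_Suc[of \<phi> v k] assms(2-4) by simp
  also have "\<dots> = ?p * (-1) ^ h"
    by (cases "even h") simp_all
  finally show ?thesis
    using gain_nonzero[OF arc[of 0]] by simp
qed

subsection \<open>Row combinations along a shortest cycle\<close>

context
  fixes v :: "nat \<Rightarrow> nat"
  assumes cyc: "periodic_cycle (parcs G) (girth G) v"
begin

lemma shortest_cycle_arc: "(v i, v (Suc i)) \<in> parcs G"
  by (rule periodic_cycle_arc[OF cyc])

lemma shortest_cycle_verts: "v i < n"
  using shortest_cycle_arc[of i] arc_verts by blast

lemmas shortest_cycle_chordless = girth_cycle_chordless[OF cyc]

lemma girth_ge_3: "3 \<le> girth G"
  by (rule periodic_cycle_length[OF cyc])

text \<open>The bound \<open>girth G - 2\<close> keeps out the column of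
  \<open>v (girth G - 1)\<close>, which is adjacent to \<open>v 0\<close>.\<close>

lemma shortest_cycle_triangular:
  assumes "i < j" "j < girth G - 2"
  shows "adj_mat $$ (v i, v (Suc j)) = 0"
  using assms shortest_cycle_chordless[of i "Suc j"]
  by (intro adj_mat_no_arc shortest_cycle_verts) auto

lemma adj_mat_cycle_arc_nonzero: "adj_mat $$ (v i, v (Suc i)) \<noteq> 0"
  by (simp add: adj_mat_arc gain_nonzero shortest_cycle_arc)

lemma girth_le_rank: "girth G \<le> factor_rank adj_mat + 2"
proof -
  have "girth G - 2 \<le> factor_rank adj_mat"
    by (rule triangular_factor_rank[OF adj_mat_carrier, where \<rho> = v and \<sigma> = "\<lambda>i. v (Suc i)"])
      (simp_all add: shortest_cycle_verts shortest_cycle_triangular adj_mat_cycle_arc_nonzero)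
  then show ?thesis by simp
qed

text \<open>The upper limit counts the even indices below the girth, for either parity of the
  girth.\<close>

definition even_row_comb :: "nat \<Rightarrow> quat" where
  "even_row_comb x = (\<Sum>i<(girth G + 1) div 2. even_coeff \<phi> v i * adj_mat $$ (v (2 * i), x))"

text \<open>By chordlessness no two vertices of even index are adjacent, except \<open>v 0\<close>
  and \<open>v (girth G - 1)\<close> when the girth is odd.\<close>

lemma even_row_comb_even:
  assumes "even j" "j < girth G" "even (girth G) \<or> 0 < j \<and> j + 1 < girth G"
  shows "even_row_comb (v j) = 0"
  unfolding even_row_comb_def
proof (rule sum.neutral, rule ballI)
  fix i assume "i \<in> {..<(girth G + 1) div 2}"
  then have "2 * i < girth G" by auto
  moreover have "2 * i \<noteq> Suc j" "j \<noteq> Suc (2 * i)"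
    using assms(1) by presburger+
  moreover have "\<not> (2 * i = 0 \<and> j = girth G - 1)" "\<not> (j = 0 \<and> 2 * i = girth G - 1)"
    using assms girth_ge_3 by presburger+
  ultimately have "(v (2 * i), v j) \<notin> parcs G"
    using shortest_cycle_chordless[of "2 * i" j] assms(2) by blast
  then show "even_coeff \<phi> v i * adj_mat $$ (v (2 * i), v j) = 0"
    by (simp add: adj_mat_no_arc shortest_cycle_verts)
qed

text \<open>Only the two cycle neighbours of \<open>v j\<close> contribute, and they cancel. The
  bound on \<open>j\<close> ensures that both carry consecutive even indices, without
  wrap-around.\<close>

lemma even_row_comb_odd:
  assumes "odd j" "j + 1 < girth G"
  shows "even_row_comb (v j) = 0"
proof -
  obtain l where l: "j = Suc (2 * l)" using assms(1) by (auto elim: oddE)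
  let ?f = "\<lambda>i. even_coeff \<phi> v i * adj_mat $$ (v (2 * i), v j)"
  have "even_row_comb (v j) = sum ?f {l, Suc l}"
    unfolding even_row_comb_def
  proof (rule sum.mono_neutral_right)
    show "{l, Suc l} \<subseteq> {..<(girth G + 1) div 2}" using assms(2) l by auto
    show "\<forall>i\<in>{..<(girth G + 1) div 2} - {l, Suc l}. ?f i = 0"
    proof
      fix i assume i: "i \<in> {..<(girth G + 1) div 2} - {l, Suc l}"
      then have "2 * i < girth G" "2 * i \<noteq> Suc j" "j \<noteq> Suc (2 * i)" "j \<noteq> 0" "j \<noteq> girth G - 1"
        using l assms(2) by auto
      then have "(v (2 * i), v j) \<notin> parcs G"
        using shortest_cycle_chordless[of "2 * i" j] assms(2) by auto
      then show "?f i = 0"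
        by (simp add: adj_mat_no_arc shortest_cycle_verts)
    qed
  qed simp
  also have "\<dots> = ?f l + ?f (Suc l)" by simp
  also have "\<dots> = 0"
    using even_coeff_cancel[of v l] shortest_cycle_arc
      shortest_cycle_arc[of "Suc (2 * l)"] arc_sym l by (simp add: adj_mat_arc)
  finally show ?thesis .
qed

text \<open>For odd girth the last vertex has even index. Of its two cycle neighbours only
  \<open>v 0\<close> occurs in the sum, so a single nonzero term remains.\<close>

lemma even_row_comb_last_odd:
  assumes "odd (girth G)"
  shows "even_row_comb (v (girth G - 1)) \<noteq> 0"
proof -
  let ?f = "\<lambda>i. even_coeff \<phi> v i * adj_mat $$ (v (2 * i), v (girth G - 1))"
  have "even_row_comb (v (girth G - 1)) = sum ?f {0}"
    unfolding even_row_comb_def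
  proof (rule sum.mono_neutral_right)
    show "{0} \<subseteq> {..<(girth G + 1) div 2}" using girth_ge_3 by auto
    show "\<forall>i\<in>{..<(girth G + 1) div 2} - {0}. ?f i = 0"
    proof
      fix i assume i: "i \<in> {..<(girth G + 1) div 2} - {0}"
      then have "2 * i < girth G" "i \<noteq> 0" by auto
      moreover have "girth G - 1 \<noteq> Suc (2 * i)" "2 * i \<noteq> Suc (girth G - 1)"
        using assms girth_ge_3 by presburger+
      ultimately have "(v (2 * i), v (girth G - 1)) \<notin> parcs G"
        using shortest_cycle_chordless[of "2 * i" "girth G - 1"] girth_ge_3 by auto
      then show "?f i = 0"
        by (simp add: adj_mat_no_arc shortest_cycle_verts)
    qed
  qed simp
  moreover have "(v 0, v (girth G - 1)) \<in> parcs G"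
    using shortest_cycle_chordless[of 0 "girth G - 1"] girth_ge_3 by auto
  ultimately show ?thesis
    by (simp add: adj_mat_arc gain_nonzero even_coeff_nonzero shortest_cycle_arc)
qed

text \<open>For even girth both neighbours of the last vertex occur, the first and the last term of
  the sum. They cancel exactly when going once around the cycle gives the right sign.\<close>

lemma even_row_comb_last_even:
  assumes h: "girth G = 2 * h"
  shows "even_row_comb (v (girth G - 1)) = 0 \<longleftrightarrow> walk_gain \<phi> (walk_arcs v (girth G)) = (-1) ^ h"
proof -
  let ?f = "\<lambda>i. even_coeff \<phi> v i * adj_mat $$ (v (2 * i), v (girth G - 1))"
  obtain m where m: "h = Suc m" "0 < m" using h girth_ge_3 by (cases h) auto
  have lst: "girth G - Suc 0 = Suc (2 * m)" using h m by simp
  have "0 < girth G" "Suc (2 * m) < girth G" using h m by simp_all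
  then have arc0: "(v 0, v (Suc (2 * m))) \<in> parcs G"
    using shortest_cycle_chordless[of 0 "Suc (2 * m)"] lst by simp
  have "even_row_comb (v (girth G - 1)) = sum ?f {m, 0}"
    unfolding even_row_comb_def
  proof (rule sum.mono_neutral_right)
    show "{m, 0} \<subseteq> {..<(girth G + 1) div 2}" using h m by auto
    show "\<forall>i\<in>{..<(girth G + 1) div 2} - {m, 0}. ?f i = 0"
    proof
      fix i assume i: "i \<in> {..<(girth G + 1) div 2} - {m, 0}"
      then have "2 * i < girth G" "i \<noteq> 0" "i \<noteq> m" by auto
      moreover have "2 * i \<noteq> Suc (girth G - 1)"
        using \<open>2 * i < girth G\<close> by linarith
      ultimately have "(v (2 * i), v (girth G - 1)) \<notin> parcs G"
        using shortest_cycle_chordless[of "2 * i" "girth G - 1"] girth_ge_3 lst by auto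
      then show "?f i = 0"
        by (simp add: adj_mat_no_arc shortest_cycle_verts)
    qed
  qed simp
  also have "\<dots> = ?f m + ?f 0" using m by simp
  also have "?f m = (-1) ^ m * walk_gain \<phi> (walk_arcs v (Suc (2 * m)))"
    using shortest_cycle_arc[of "2 * m"]
    by (simp add: lst adj_mat_arc even_coeff_def walk_gain_Suc mult.assoc)
  also have "?f 0 = \<phi> (v 0, v (Suc (2 * m)))"
    using arc0 by (simp add: lst adj_mat_arc even_coeff_def)
  finally have "even_row_comb (v (girth G - 1)) = 0 \<longleftrightarrow>
      (-1) ^ m * walk_gain \<phi> (walk_arcs v (Suc (2 * m))) = - \<phi> (v 0, v (Suc (2 * m)))"
    by (simp add: eq_neg_iff_add_eq_0)
  also have "\<dots> \<longleftrightarrow>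
      walk_gain \<phi> (walk_arcs v (Suc (2 * m))) = (-1) ^ h * \<phi> (v 0, v (Suc (2 * m)))"
    unfolding m by (cases "even m") (auto simp: minus_equation_iff)
  \<comment> \<open>Reading \<open>v 0\<close> as the end of the round makes the entry the reverse
    of the closing arc, which then moves to the other side.\<close>
  also have "v 0 = v (Suc (Suc (2 * m)))"
    using h m by (simp add: periodic_cycle_eq_iff[OF cyc])
  also have "walk_gain \<phi> (walk_arcs v (Suc (2 * m)))
        = (-1) ^ h * \<phi> (v (Suc (Suc (2 * m))), v (Suc (2 * m)))
      \<longleftrightarrow> walk_gain \<phi> (walk_arcs v (Suc (Suc (2 * m)))) = (-1) ^ h"
    using walk_gain_Suc_eq_iff[of v "Suc (2 * m)" "(-1) ^ h"] shortest_cycle_arc by blast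
  also have "Suc (Suc (2 * m)) = girth G" using h m by simp
  finally show ?thesis .
qed

text \<open>The columns \<open>v 1, ..., v (girth G - 2)\<close> of the triangular submatrix vanish
  for any gains; minimal rank extends this to all columns.\<close>

lemma even_row_comb_minimal_rank:
  assumes "girth G = factor_rank adj_mat + 2" "x < n"
  shows "even_row_comb x = 0"
  unfolding even_row_comb_def
proof (rule row_combination_vanishes[OF adj_mat_carrier,
      where m = "girth G - 2" and \<rho> = v and \<sigma> = "\<lambda>i. v (Suc i)"])
  fix j assume "j < girth G - 2"
  then have "even_row_comb (v (Suc j)) = 0"
    by (cases "even (Suc j)") (auto intro: even_row_comb_even even_row_comb_odd)
  then show "(\<Sum>i<(girth G + 1) div 2. even_coeff \<phi> v i * adj_mat $$ (v (2 * i), v (Suc j))) = 0"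
    by (simp add: even_row_comb_def)
qed (use assms in \<open>simp_all add: shortest_cycle_verts shortest_cycle_triangular
      adj_mat_cycle_arc_nonzero\<close>)

lemma minimal_rank_even: "girth G = factor_rank adj_mat + 2 \<Longrightarrow> even (girth G)"
  using even_row_comb_minimal_rank even_row_comb_last_odd shortest_cycle_verts by blast

lemma minimal_rank_gain:
  assumes "girth G = factor_rank adj_mat + 2"
  shows "walk_gain \<phi> (walk_arcs v (girth G)) = (-1) ^ (girth G div 2)"
  using even_row_comb_last_even[of "girth G div 2"] minimal_rank_even[OF assms]
    even_row_comb_minimal_rank[OF assms shortest_cycle_verts] by simp

text \<open>The column of \<open>u\<close> in the vanishing row combination must have a second nonzero entry.\<close>

lemma minimal_rank_outside_neighbour:
  assumes "girth G = factor_rank adj_mat + 2" "u \<notin> range v" "(v 0, u) \<in> parcs G"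
  shows "girth G = 4"
proof -
  have u: "u < n" using assms(3) arc_verts by blast
  let ?h = "(girth G + 1) div 2"
  \<comment> \<open>Otherwise the term of \<open>v 0\<close> would be the only nonzero one in the
    column of \<open>u\<close>.\<close>
  have "\<exists>i<?h. 0 < i \<and> (v (2 * i), u) \<in> parcs G"
  proof (rule ccontr)
    assume none: "\<not> ?thesis"
    have "even_row_comb u = (\<Sum>i\<in>{0}. even_coeff \<phi> v i * adj_mat $$ (v (2 * i), u))"
      unfolding even_row_comb_def using girth_ge_3 none
      by (intro sum.mono_neutral_right) (auto simp: adj_mat_no_arc shortest_cycle_verts u)
    then show False
      using even_row_comb_minimal_rank[OF assms(1) u] assms(3)
      by (simp add: adj_mat_arc gain_nonzero even_coeff_nonzero shortest_cycle_arc)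
  qed
  then obtain i where i: "i < ?h" "0 < i" "(v (2 * i), u) \<in> parcs G" by blast
  then have i': "2 * i < girth G" by auto
  \<comment> \<open>The detour through \<open>u\<close> closes up either of the two arcs of the
    cycle between \<open>v 0\<close> and \<open>v (2 * i)\<close>. Adding the two bounds gives girth
    at most 4.\<close>
  have "girth G \<le> 2 * i + 2"
    using periodic_cycle_detour[OF cyc, of "2 * i" u] i i' assms(2,3) arc_sym girth_le by auto
  moreover have "girth G \<le> girth G - 2 * i + 2"
  proof -
    have "v (girth G - 2 * i + 2 * i) = v 0"
      using i' by (simp add: periodic_cycle_eq_iff[OF cyc])
    moreover have "u \<notin> range (\<lambda>l. v (l + 2 * i))" "1 \<le> girth G - 2 * i"
      using assms(2) i' by auto
    ultimately show ?thesis
      using periodic_cycle_detour[OF periodic_cycle_shift[OF cyc, of "2 * i"],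
          of "girth G - 2 * i" u] i assms(3) arc_sym girth_le by auto
  qed
  ultimately have "girth G \<le> 4" using i' by linarith
  then show ?thesis
    using girth_ge_3 minimal_rank_even[OF assms(1)] by presburger
qed

end

subsection \<open>Girth four and minimal rank\<close>

lemma triangle_free:
  assumes "girth G = 4" "(x, y) \<in> parcs G" "(y, z) \<in> parcs G"
  shows "(x, z) \<notin> parcs G"
proof
  assume "(x, z) \<in> parcs G"
  define w where "w = (\<lambda>i. [x, y, z] ! i)"
  have "inj_on w {..<3}"
    using assms \<open>(x, z) \<in> parcs G\<close> arc_irrefl
    by (auto simp: w_def inj_on_def numeral_3_eq_3 less_Suc_eq)
  moreover have "(w i, w (Suc i)) \<in> parcs G" if "Suc i < 3" for i
    using that assms(2,3) by (auto simp: w_def numeral_3_eq_3 less_Suc_eq)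
  moreover have "(w (3 - 1), w 0) \<in> parcs G"
    using \<open>(x, z) \<in> parcs G\<close> arc_sym by (auto simp: w_def)
  ultimately have "girth G \<le> 3"
    using periodic_cycleI[of 3 w] girth_le by blast
  then show False using assms(1) by simp
qed

text \<open>If \<open>a\<close> and \<open>d\<close> were not adjacent, the rows
  \<open>a, b, c\<close> and columns \<open>b, a, d\<close> would form a triangular matrix of size 3
  with nonzero diagonal; absence of triangles supplies the zero at \<open>(b, d)\<close>.\<close>

lemma rank_2_three_walk_closes:
  assumes "girth G = 4" "factor_rank adj_mat = 2"
    and arcs: "(a, b) \<in> parcs G" "(b, c) \<in> parcs G" "(c, d) \<in> parcs G"
  shows "(a, d) \<in> parcs G"
proof (rule ccontr)
  assume ad: "(a, d) \<notin> parcs G"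
  have lt: "a < n" "b < n" "c < n" "d < n" using arcs arc_verts by auto
  have bd: "(b, d) \<notin> parcs G" using triangle_free assms by blast
  define \<rho> where "\<rho> i = [a, b, c] ! i" for i
  define \<sigma> where "\<sigma> i = [b, a, d] ! i" for i
  have "3 \<le> factor_rank adj_mat"
  proof (rule triangular_factor_rank[OF adj_mat_carrier, where \<rho> = \<rho> and \<sigma> = \<sigma>])
    show "\<rho> i < n" "\<sigma> i < n" if "i < 3" for i
      using that lt by (auto simp: \<rho>_def \<sigma>_def numeral_3_eq_3 less_Suc_eq)
    show "adj_mat $$ (\<rho> i, \<sigma> i) \<noteq> 0" if "i < 3" for i
      using that arcs arc_sym[of a b]
      by (auto simp: \<rho>_def \<sigma>_def numeral_3_eq_3 less_Suc_eq adj_mat_arc gain_nonzero)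
    show "adj_mat $$ (\<rho> i, \<sigma> j) = 0" if "i < j" "j < 3" for i j
      using that ad bd lt arc_irrefl
      by (auto simp: \<rho>_def \<sigma>_def numeral_3_eq_3 less_Suc_eq adj_mat_no_arc)
  qed
  then show False using assms(2) by simp
qed

lemma rank_2_complete_bipartite:
  assumes conn: "Digraph_Component.connected (with_proj G)"
    and cyc: "periodic_cycle (parcs G) (girth G) v"
    and g: "girth G = 4" and r: "factor_rank adj_mat = 2"
  shows "\<exists>s t. 2 \<le> s \<and> 2 \<le> t \<and> complete_bipartite_digraph s t (with_proj G)"
proof -
  note closes = rank_2_three_walk_closes[OF g r] and tri = triangle_free[OF g]
  have arc: "(v i, v (Suc i)) \<in> parcs G" for i
    by (rule periodic_cycle_arc[OF cyc])
  have v4: "v 4 = v 0" using g by (simp add: periodic_cycle_eq_iff[OF cyc])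
  have a01: "(v 0, v 1) \<in> parcs G" and a12: "(v 1, v 2) \<in> parcs G"
    and a30: "(v 3, v 0) \<in> parcs G"
    using arc[of 0] arc[of 1] arc[of 3] v4 by (simp_all add: numeral_2_eq_2)
  \<comment> \<open>The parts are the neighbourhoods of the two ends of one arc. Closing walks of
    three arcs makes them completely joined and closed under adjacency, so by connectedness they
    cover all vertices.\<close>
  define U where "U = {x. (x, v 1) \<in> parcs G}"
  define W where "W = {y. (v 0, y) \<in> parcs G}"
  have sub: "U \<union> W \<subseteq> pverts G"
    using arc_verts verts_eq by (auto simp: U_def W_def)
  have UW: "(x, y) \<in> parcs G" if "x \<in> U" "y \<in> W" for x y
    using closes[of x "v 1" "v 0" y] that a01 arc_sym by (auto simp: U_def W_def)
  have U_nbr: "y \<in> W" if "x \<in> U" "(x, y) \<in> parcs G" for x y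
    using closes[of "v 0" "v 1" x y] that a01 arc_sym by (auto simp: U_def W_def)
  have W_nbr: "y \<in> U" if "x \<in> W" "(x, y) \<in> parcs G" for x y
    using closes[of y x "v 0" "v 1"] that a01 arc_sym by (auto simp: U_def W_def)
  have "v 0 \<in> U" using a01 by (simp add: U_def)
  then have verts: "U \<union> W = pverts G"
    using U_nbr W_nbr by (intro connected_closed_set[OF conn sub, of "v 0"]) auto
  have disj: "U \<inter> W = {}"
    using tri[OF a01] arc_sym by (auto simp: U_def W_def)
  have "parcs G \<subseteq> U \<times> W \<union> W \<times> U"
  proof
    fix e assume "e \<in> parcs G"
    then obtain x y where e: "e = (x, y)" "(x, y) \<in> parcs G" by (cases e) auto
    then have "x \<in> U \<union> W" using verts arc_verts verts_eq by auto
    then show "e \<in> U \<times> W \<union> W \<times> U" using e U_nbr W_nbr by auto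
  qed
  moreover have "(y, x) \<in> parcs G" if "x \<in> U" "y \<in> W" for x y
    using UW[OF that] arc_sym by blast
  ultimately have arcs_eq: "parcs G = U \<times> W \<union> W \<times> U"
    using UW by auto
  have fin: "finite U" "finite W"
    using sub finite_subset[of U "pverts G"] finite_subset[of W "pverts G"] verts_eq by auto
  have "{v 0, v 2} \<subseteq> U" "{v 1, v 3} \<subseteq> W"
    using a01 a12 a30 arc_sym by (auto simp: U_def W_def)
  moreover have "card {v 0, v 2} = 2" "card {v 1, v 3} = 2"
    using g by (auto simp: card_2_iff periodic_cycle_eq_iff[OF cyc])
  ultimately have "2 \<le> card U" "2 \<le> card W"
    using card_mono fin by metis+
  moreover have "complete_bipartite_digraph (card U) (card W) (with_proj G)"
    unfolding complete_bipartite_digraph_pair_def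
    using verts disj arcs_eq verts_eq by auto
  ultimately show ?thesis by blast
qed

text \<open>Without girth 4 no vertex of the cycle has an outside neighbour, so by connectedness the
  cycle covers \<open>G\<close>. Chordlessness leaves no further arcs.\<close>

lemma minimal_rank_cycle_graph:
  assumes conn: "Digraph_Component.connected (with_proj G)"
    and cyc: "periodic_cycle (parcs G) (girth G) v"
    and rank: "girth G = factor_rank adj_mat + 2"
    and "girth G \<noteq> 4"
  shows "is_cycle_graph G (walk_arcs v (girth G))"
proof -
  let ?g = "girth G"
  note len = periodic_cycle_length[OF cyc]
  have "range v = pverts G"
  proof (rule connected_closed_set[OF conn, of _ "v 0"])
    show "range v \<subseteq> pverts G"
      using periodic_cycle_arc[OF cyc] arc_verts verts_eq by fastforce
    fix x y assume "x \<in> range v" "(x, y) \<in> parcs G"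
    then obtain i where i: "(v i, y) \<in> parcs G" by auto
    have "y \<in> range (\<lambda>l. v (l + i))"
      using minimal_rank_outside_neighbour[OF periodic_cycle_shift[OF cyc, of i] rank, of y]
        i assms(4) by auto
    then show "y \<in> range v" by auto
  qed simp
  then have verts: "pverts G = v ` {..<?g}"
    using periodic_cycle_range[OF cyc] by simp
  have set_p: "set (walk_arcs v ?g) = (\<lambda>i. (v i, v (Suc i))) ` {..<?g}"
    by (auto simp: walk_arcs_def)
  have "parcs G \<subseteq> set (walk_arcs v ?g) \<union> (set (walk_arcs v ?g))\<inverse>"
  proof
    fix e assume e: "e \<in> parcs G"
    then have "fst e \<in> v ` {..<?g}" "snd e \<in> v ` {..<?g}"
      using verts arc_verts[of "fst e" "snd e"] verts_eq by auto
    then obtain i j where ij: "e = (v i, v j)" "i < ?g" "j < ?g"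
      by (auto simp: prod_eq_iff)
    have "v 0 = v (Suc (?g - 1))"
      using len by (simp add: periodic_cycle_eq_iff[OF cyc])
    then show "e \<in> set (walk_arcs v ?g) \<union> (set (walk_arcs v ?g))\<inverse>"
      using girth_cycle_chordless[OF cyc ij(2,3)] e ij len unfolding set_p by force
  qed
  moreover have "set (walk_arcs v ?g) \<union> (set (walk_arcs v ?g))\<inverse> \<subseteq> parcs G"
    using periodic_cycle_arc[OF cyc] arc_sym unfolding set_p by auto
  moreover have "simple_cycle G (walk_arcs v ?g)"
    using simple_cycle_iff[of "walk_arcs v ?g"] cyc by auto
  ultimately show ?thesis
    unfolding is_cycle_graph_def using verts by (auto simp: set_p image_image)
qed

subsection \<open>Upper bounds for the rank\<close>

lemma even_row_comb_zero:
  assumes cyc: "periodic_cycle (parcs G) (girth G) v" and "girth G = 2 * h"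
    and "walk_gain \<phi> (walk_arcs v (girth G)) = (-1) ^ h"
    and "x \<in> range v"
  shows "even_row_comb v x = 0"
proof -
  obtain j where j: "j < girth G" "x = v j"
    using assms(4) periodic_cycle_range[OF cyc] by auto
  consider "even j" | "odd j" "j + 1 < girth G" | "j = girth G - 1"
    using j by linarith
  then show ?thesis
    using even_row_comb_even[OF cyc] even_row_comb_odd[OF cyc]
      even_row_comb_last_even[OF cyc assms(2)] assms(2,3) j by cases auto
qed

text \<open>The relation among even rows expresses the row of \<open>v (girth G - 2)\<close> by
  earlier ones. The same relation for the cycle shifted by one does so for
  \<open>v (girth G - 1)\<close>, using the odd rows.\<close>

lemma cycle_graph_rank_le:
  assumes cyc: "periodic_cycle (parcs G) (girth G) v" and g: "girth G = 2 * h"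
    and gain: "walk_gain \<phi> (walk_arcs v (girth G)) = (-1) ^ h"
    and verts: "pverts G = range v"
  shows "factor_rank adj_mat \<le> girth G - 2"
proof -
  let ?v = "\<lambda>i. v (i + 1)"
  obtain m where m: "h = Suc m" using g periodic_cycle_length[OF cyc] by (cases h) auto
  have g': "girth G - 2 = 2 * m" "(girth G + 1) div 2 = Suc m" "girth G = Suc (Suc (2 * m))"
    using g m by auto
  note arc = periodic_cycle_arc[OF cyc] and cyc' = periodic_cycle_shift[OF cyc, of 1]
  have arc': "(?v i, ?v (Suc i)) \<in> parcs G" for i using arc[of "Suc i"] by simp
  have per: "v (girth G) = v 0" "v (Suc (girth G)) = v 1"
    by (simp_all add: periodic_cycle_eq_iff[OF cyc] mod_Suc)
  have gain': "walk_gain \<phi> (walk_arcs ?v (girth G)) = (-1) ^ h"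
    using walk_gain_shift[of v "girth G" h] arc per gain by simp
  have range': "range ?v = range v"
  proof -
    have "v i \<in> range ?v" for i
    proof -
      have "i + girth G - 1 + 1 = i + girth G" using g'(3) by simp
      then have "v i = ?v (i + girth G - 1)"
        by (simp only: periodic_cycle_eq_iff[OF cyc] mod_add_self2)
      then show ?thesis by blast
    qed
    then show ?thesis by auto
  qed
  \<comment> \<open>Solves a left relation for its last row; the inverse must multiply from the
    left.\<close>
  have last_row: "b m = (\<Sum>i<m. - inverse (c m) * c i * b i)"
    if "(\<Sum>i<Suc m. c i * b i) = 0" "c m \<noteq> 0" for b c :: "nat \<Rightarrow> quat"
  proof -
    have "c m * b m = - (\<Sum>i<m. c i * b i)"
      using that(1) by (simp add: eq_neg_iff_add_eq_0 add.commute)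
    then have "inverse (c m) * (c m * b m) = inverse (c m) * - (\<Sum>i<m. c i * b i)"
      by simp
    moreover have "inverse (c m) * (c m * b m) = b m"
      using that(2) by (simp flip: mult.assoc)
    ultimately show ?thesis
      by (simp add: sum_distrib_left sum_negf mult.assoc)
  qed
  \<comment> \<open>Splits a sum over the first \<open>2 * m\<close> rows by parity, so that
    coefficients supported on one parity class reproduce the shorter sum.\<close>
  have even_odd: "(\<Sum>t<2 * m. F t) = (\<Sum>i<m. F (2 * i) + F (Suc (2 * i)))"
    for F :: "nat \<Rightarrow> quat" and m
    by (induction m) (simp_all add: add.assoc)
  have "factor_rank adj_mat \<le> 2 * m"
  proof (rule factor_rank_le[OF adj_mat_carrier, where \<rho> = v])
    show "v t < n" for t using verts verts_eq by auto
    fix x assume "x < n"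
    then have "x \<in> v ` {..<girth G}"
      using verts verts_eq periodic_cycle_range[OF cyc] by auto
    then obtain l where l: "x = v l" "l < girth G" by auto
    from l(2) have "l < 2 * m \<or> l = 2 * m \<or> l = Suc (2 * m)" using g'(3) by linarith
    then show "\<exists>f. \<forall>y<n. adj_mat $$ (x, y) = (\<Sum>t<2 * m. f t * adj_mat $$ (v t, y))"
    proof (elim disjE)
      assume "l < 2 * m"
      then have "adj_mat $$ (x, y) = (\<Sum>t<2 * m. (if t = l then 1 else 0) * adj_mat $$ (v t, y))" for y
        by (simp add: l(1) if_distrib[of "\<lambda>a. a * _"] cong: if_cong)
      then show ?thesis by (intro exI[of _ "\<lambda>t. if t = l then 1 else 0"]) blast
    next
      assume lm: "l = 2 * m"
      let ?c = "even_coeff \<phi> v"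
      let ?f = "\<lambda>t. if even t then - inverse (?c m) * ?c (t div 2) else 0"
      have "adj_mat $$ (x, y) = (\<Sum>t<2 * m. ?f t * adj_mat $$ (v t, y))" if "y < n" for y
      proof -
        have "y \<in> range v" using that verts verts_eq by auto
        then have "(\<Sum>i<Suc m. ?c i * adj_mat $$ (v (2 * i), y)) = 0"
          using even_row_comb_zero[OF cyc g gain, of y]
          unfolding even_row_comb_def[OF cyc] g'(2) by blast
        moreover have "?c m \<noteq> 0" by (rule even_coeff_nonzero) (rule arc)
        ultimately have "adj_mat $$ (v (2 * m), y)
            = (\<Sum>i<m. - inverse (?c m) * ?c i * adj_mat $$ (v (2 * i), y))"
          by (rule last_row[of ?c "\<lambda>i. adj_mat $$ (v (2 * i), y)"])
        then show ?thesis unfolding l(1) lm even_odd by simp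
      qed
      then show ?thesis by (intro exI[of _ ?f]) blast
    next
      assume lm: "l = Suc (2 * m)"
      let ?c = "even_coeff \<phi> ?v"
      let ?f = "\<lambda>t. if odd t then - inverse (?c m) * ?c (t div 2) else 0"
      have "adj_mat $$ (x, y) = (\<Sum>t<2 * m. ?f t * adj_mat $$ (v t, y))" if "y < n" for y
      proof -
        have "y \<in> range ?v" using that verts verts_eq range' by auto
        then have "(\<Sum>i<Suc m. ?c i * adj_mat $$ (?v (2 * i), y)) = 0"
          using even_row_comb_zero[OF cyc' g gain', of y]
          unfolding even_row_comb_def[OF cyc'] g'(2) by blast
        moreover have "?c m \<noteq> 0" by (rule even_coeff_nonzero) (rule arc')
        ultimately have "adj_mat $$ (?v (2 * m), y)
            = (\<Sum>i<m. - inverse (?c m) * ?c i * adj_mat $$ (?v (2 * i), y))"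
          by (rule last_row[of ?c "\<lambda>i. adj_mat $$ (?v (2 * i), y)"])
        then show ?thesis unfolding l(1) lm even_odd by simp
      qed
      then show ?thesis by (intro exI[of _ ?f]) blast
    qed
  qed
  then show ?thesis using g' by simp
qed

text \<open>Gain 1 on a 4-cycle means that one arc has the gain of the walk along the other three.
  Hence each row is a left multiple of the row of \<open>a\<close> or of \<open>b\<close>, one fixed
  vertex from each part.\<close>

lemma complete_bipartite_rank_le_2:
  assumes "complete_bipartite_digraph s t (with_proj G)" "2 \<le> s" "2 \<le> t"
    and gain: "\<And>p. simple_cycle G p \<Longrightarrow> length p = 4 \<Longrightarrow> walk_gain \<phi> p = 1"
  shows "factor_rank adj_mat \<le> 2"
proof -
  from assms(1) obtain U W where
    UW: "pverts G = U \<union> W" "U \<inter> W = {}" "card U = s" "card W = t"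
      "parcs G = U \<times> W \<union> W \<times> U"
    unfolding complete_bipartite_digraph_pair_def by blast
  from UW(3,4) assms(2,3) have "U \<noteq> {}" "W \<noteq> {}" by auto
  then obtain a b where ab: "a \<in> U" "b \<in> W" by auto
  have square: "\<phi> (x, y) = \<phi> (x, d) * \<phi> (d, c) * \<phi> (c, y)"
    if arcs: "(x, d) \<in> parcs G" "(d, c) \<in> parcs G" "(c, y) \<in> parcs G" "(x, y) \<in> parcs G"
    for x y c d
  \<comment> \<open>In the degenerate case the walk of three arcs retraces an arc, and two inverse
    gains cancel.\<close>
  proof (cases "x = c \<or> y = d")
    case True
    then show ?thesis
    proof
      assume "x = c"
      then show ?thesis using gain_mult_rev[OF arcs(1)] by simp
    next
      assume "y = d"
      then show ?thesis using gain_mult_rev[OF arcs(2)] by (simp add: mult.assoc)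
    qed
  next
    case False
    define w where "w = (\<lambda>i. [x, d, c, y] ! i)"
    have "inj_on w {..<4}"
      using False arcs arc_irrefl by (auto simp: inj_on_def w_def eval_nat_numeral less_Suc_eq)
    moreover have "(w i, w (Suc i)) \<in> parcs G" if "Suc i < 4" for i
      using that arcs by (auto simp: w_def eval_nat_numeral less_Suc_eq)
    moreover have "(w (4 - 1), w 0) \<in> parcs G"
      using arcs(4) arc_sym[of x y] by (simp add: w_def)
    ultimately have "periodic_cycle (parcs G) 4 (\<lambda>i. w (i mod 4))"
      using periodic_cycleI[of 4 w] by simp
    then have "walk_gain \<phi> (walk_arcs (\<lambda>i. w (i mod 4)) 4) = 1"
      using gain simple_cycle_iff by (metis length_walk_arcs)
    then have "\<phi> (x, d) * \<phi> (d, c) * \<phi> (c, y) * \<phi> (y, x) = 1"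
      by (simp add: walk_gain_def walk_arcs_def w_def upt_conv_Cons mult.assoc)
    then have "\<phi> (x, d) * \<phi> (d, c) * \<phi> (c, y) * (\<phi> (y, x) * \<phi> (x, y)) = \<phi> (x, y)"
      by (simp flip: mult.assoc)
    then show ?thesis using gain_mult_rev[of y x] arcs(4) arc_sym by simp
  qed
  show ?thesis
  proof (rule factor_rank_le[OF adj_mat_carrier, where \<rho> = "\<lambda>i. if i = 0 then a else b"])
    show "(if i = 0 then a else b) < n" for i :: nat
      using ab UW(1) verts_eq by auto
    fix x assume "x < n"
    let ?f = "\<lambda>i::nat. if x \<in> U then (if i = 0 then \<phi> (x, b) * \<phi> (b, a) else 0)
      else (if i = 0 then 0 else \<phi> (x, a) * \<phi> (a, b))"
    have "adj_mat $$ (x, y) = (\<Sum>i<2. ?f i * adj_mat $$ (if i = 0 then a else b, y))"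
      if "y < n" for y
    proof -
      have "x \<in> U \<union> W" "y \<in> U \<union> W" "a < n" "b < n"
        using \<open>x < n\<close> that UW(1) verts_eq ab by auto
      then consider "x \<in> U" "y \<in> W" | "x \<in> W" "y \<in> U" | "x \<in> U" "y \<in> U" | "x \<in> W" "y \<in> W"
        by blast
      then show ?thesis
      proof cases
        case 1
        then show ?thesis
          using square[of x b a y] UW(5) ab
          by (simp add: numeral_2_eq_2 adj_mat_arc)
      next
        case 2
        then have "x \<notin> U" using UW(2) by blast
        then show ?thesis
          using square[of x a b y] UW(5) ab 2
          by (simp add: numeral_2_eq_2 adj_mat_arc)
      next
        case 3
        then have "(x, y) \<notin> parcs G" "(a, y) \<notin> parcs G" using UW(2,5) ab by auto
        then show ?thesis
          using 3 \<open>x < n\<close> \<open>y < n\<close> \<open>a < n\<close> by (simp add: numeral_2_eq_2 adj_mat_no_arc)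
      next
        case 4
        then have "(x, y) \<notin> parcs G" "(b, y) \<notin> parcs G" "x \<notin> U" using UW(2,5) ab by auto
        then show ?thesis
          using 4 \<open>x < n\<close> \<open>y < n\<close> \<open>b < n\<close> by (simp add: numeral_2_eq_2 adj_mat_no_arc)
      qed
    qed
    then show "\<exists>f. \<forall>y<n. adj_mat $$ (x, y)
        = (\<Sum>i<2::nat. f i * adj_mat $$ (if i = 0 then a else b, y))"
      by (intro exI[of _ ?f]) blast
  qed
qed

end

section \<open>The rank bound and its equality case\<close>

theorem theorem1:
  fixes G :: "nat pair_pre_digraph" and n g r :: nat and \<phi> :: "nat \<times> nat \<Rightarrow> quat"
  assumes "quat_unit_gain_graph G n \<phi>"
    and "Digraph_Component.connected (with_proj G)"
    and "\<not> simple_tree G"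
    and "g = girth G"
    and "r = factor_rank (gain_adj_mat n G \<phi>)"
  shows "g \<le> r + 2 \<and>
    (g = r + 2 \<longleftrightarrow>
      even g \<and>
      ((\<exists>p. is_cycle_graph G p \<and> length p = g \<and> walk_gain \<phi> p = (-1) ^ (g div 2)) \<or>
       ((\<exists>s t. 2 \<le> s \<and> 2 \<le> t \<and> complete_bipartite_digraph s t (with_proj G)) \<and>
        (\<forall>p. simple_cycle G p \<and> length p = 4 \<longrightarrow> walk_gain \<phi> p = 1))))"
    (is "_ \<and> (_ \<longleftrightarrow> even g \<and> (?cycle \<or> ?bipartite))")
proof -
  interpret quat_unit_gain_graph G n \<phi> by fact
  obtain p where "simple_cycle G p" using assms(2,3) by (auto simp: simple_tree_def)
  then obtain v where cyc: "periodic_cycle (parcs G) (girth G) v" by (rule girth_attained)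
  have le: "g \<le> r + 2" using girth_le_rank[OF cyc] assms(4,5) by simp
  have "even g \<and> (?cycle \<or> ?bipartite)" if "g = r + 2"
  proof -
    have rank: "girth G = factor_rank adj_mat + 2" using that assms(4,5) by simp
    \<comment> \<open>The alternatives are split at girth 4: a 4-cycle is also complete bipartite
      and is treated as such here.\<close>
    have "?cycle" if "g \<noteq> 4"
      using minimal_rank_cycle_graph[OF assms(2) cyc rank] minimal_rank_gain[OF cyc rank]
        that assms(4) by (intro exI[of _ "walk_arcs v g"]) simp
    moreover have "?bipartite" if "g = 4"
    proof -
      have g4: "girth G = 4" "factor_rank adj_mat = 2" using that rank assms(4) by simp_all
      have "walk_gain \<phi> p = 1" if p: "simple_cycle G p" "length p = 4" for p
      proof -
        from p obtain w where "periodic_cycle (parcs G) (girth G) w" "p = walk_arcs w (girth G)"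
          using g4 simple_cycle_iff[of p] by auto
        then show ?thesis using minimal_rank_gain[OF _ rank, of w] g4 by simp
      qed
      then show ?thesis using rank_2_complete_bipartite[OF assms(2) cyc g4] by blast
    qed
    moreover have "even g" using minimal_rank_even[OF cyc rank] assms(4) by simp
    ultimately show ?thesis by argo
  qed
  moreover have "g = r + 2" if "even g" "?cycle \<or> ?bipartite"
    using that(2)
  proof
    assume ?cycle
    then obtain p where p: "is_cycle_graph G p" "length p = g" "walk_gain \<phi> p = (-1) ^ (g div 2)"
      by blast
    then obtain w where w: "periodic_cycle (parcs G) (girth G) w" "p = walk_arcs w (girth G)"
      using simple_cycle_iff[of p] assms(4) by (auto simp: is_cycle_graph_def)
    have "pverts G = range w"
      using p(1) w(2) periodic_cycle_range[OF w(1)]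
      by (simp add: is_cycle_graph_def walk_arcs_def image_image atLeast0LessThan)
    then have "r \<le> g - 2"
      using cycle_graph_rank_le[OF w(1), of "g div 2"] p(3) w(2) that(1) assms(4,5) by simp
    then show ?thesis
      using le periodic_cycle_length[OF cyc] assms(4) by linarith
  next
    assume ?bipartite
    then have "r \<le> 2" using complete_bipartite_rank_le_2 assms(5) by blast
    \<comment> \<open>An even girth of at least 3 is at least 4, while \<open>r\<close> is at most
      2, so the bound \<open>le\<close> is an equality.\<close>
    then show ?thesis
      using le periodic_cycle_length[OF cyc] assms(4) that(1) by presburger
  qed
  ultimately show ?thesis using le by blast
qed

end
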